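(* Let $\theta=\frac{\sqrt{10}-2}{3}$, $\rho=\frac{\sqrt{10}-1}{3}$, and let $\mathbf{s}'=s_1s_2s_3\ldots$ be the Sturmian word of slope $\theta$ and intercept $\rho$, given by $s_n=\lfloor (n+1)\theta+\rho\rfloor-\lfloor n\theta+\rho\rfloor$ for $n\ge1$. Then $\mathrm{rep}(\mathbf{s}')=\sqrt{10}-\frac32$.
   Context: For an infinite word $\mathbf{x}=x_1x_2\ldots$, with $x_i^j=x_i\cdots x_j$, let $r(n,\mathbf{x})=\min\{m\ge1:\ x_i^{i+n-1}=x_{m-n+1}^{m}\text{ for some } 1\le i\le m-n\}$, and $\mathrm{rep}(\mathbf{x})=\liminf_{n\to\infty} r(n,\mathbf{x})/n$. (For these $\theta,\rho$, $n\theta+\rho$ is never an integer for $n\ge1$, so using ceilings instead of floors gives the same word.) *)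

theory Defs
  imports Complex_Main "HOL-Library.Extended_Real"
begin

(* Infinite words are functions nat => 'a, with letters x 1, x 2, ... (x 0 is ignored). *)

definition factor_eq :: "(nat \<Rightarrow> 'a) \<Rightarrow> nat \<Rightarrow> nat \<Rightarrow> nat \<Rightarrow> bool" where
  "factor_eq x n i j \<longleftrightarrow> (\<forall>k<n. x (i + k) = x (j + k))"

definition rfun :: "nat \<Rightarrow> (nat \<Rightarrow> 'a) \<Rightarrow> nat" where
  "rfun n x = (LEAST m. m \<ge> 1 \<and> n \<le> m \<and>
      (\<exists>i. 1 \<le> i \<and> i + n \<le> m \<and> factor_eq x n i (m + 1 - n)))"

definition rep :: "(nat \<Rightarrow> 'a) \<Rightarrow> ereal" where
  "rep x = liminf (\<lambda>n. ereal (real (rfun n x) / real n))"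

definition sturmian :: "real \<Rightarrow> real \<Rightarrow> nat \<Rightarrow> int" where
  "sturmian \<theta> \<rho> n = \<lfloor>(real n + 1) * \<theta> + \<rho>\<rfloor> - \<lfloor>real n * \<theta> + \<rho>\<rfloor>"

end

theory Submission
  imports Defs
begin

text \<open>
  Put \<open>\<theta> = (\<surd>10 - 2)/3\<close>. Since \<open>\<rho> = \<theta> + 1/3\<close>, the letters are governed by the orbit points
  \<open>z = u + 1/3 + v \<theta>\<close> with integers \<open>u\<close> and \<open>v\<close>, the point with coefficient \<open>v\<close> being visited at time
  \<open>v - 1\<close>. The factors of length \<open>n\<close> at \<open>i\<close> and \<open>i + q\<close> agree iff for some \<open>\<lambda> = p + q \<theta>\<close> no pair
  \<open>z\<close>, \<open>z + \<lambda>\<close> with \<open>i + 1 \<le> v \<le> i + 1 + n\<close> has different signs; call a \<open>z\<close> where the signs differ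
  a hit of \<open>\<lambda>\<close>. At hits \<open>z\<close> is bounded, so up to a constant factor and a bounded error time is measured
  by the negated Galois conjugate \<open>w\<close>.

  Multiplication by the unit \<open>3 - \<surd>10\<close> maps the coset \<open>1/3 + \<int> + \<int>\<theta>\<close> onto itself, reverses all signs
  (hence preserves hits) and multiplies \<open>w\<close> by \<open>3 + \<surd>10\<close>. With \<open>c = \<surd>10 - 5/2\<close>, the lower bound is the
  scale invariant assertion that from every \<open>S \<ge> 0\<close> on there is a hit of \<open>\<lambda>\<close> with \<open>w > S\<close> and
  \<open>c (w - S) \<le> S + w(\<lambda>)\<close>. It suffices to prove this for \<open>1 \<le> w(\<lambda>) < 3 + \<surd>10\<close>, which leaves
  finitely many \<open>\<lambda>\<close> besides those that are so large that hits abound. Equality holds for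
  \<open>\<lambda> = \<theta> - 1\<close> and \<open>S = 0\<close>, and the images of this \<open>\<lambda>\<close> under the powers of the unit give the
  repetitions that realise the limit inferior.
\<close>

section \<open>Coordinates in the field of sqrt 10, and hits\<close>

definition slope :: real where "slope = (sqrt 10 - 2) / 3"

definition coslope :: real where "coslope = (sqrt 10 + 2) / 3"

definition pos :: "real \<Rightarrow> real \<Rightarrow> real" where "pos x y = x + y * slope"

definition wt :: "real \<Rightarrow> real \<Rightarrow> real" where "wt x y = y * coslope - x"

text \<open>The arguments of \<open>pos\<close> and \<open>wt\<close> are the coefficients of an element of the number field with respect
  to the basis \<open>1, \<theta>\<close>; the prefix \<open>c\<close> refers to the coset \<open>1/3 + \<int> + \<int>\<theta>\<close>, the prefix \<open>l\<close> to
  the lattice \<open>\<int> + \<int>\<theta>\<close>.\<close>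

abbreviation cpos :: "int \<Rightarrow> int \<Rightarrow> real" where "cpos u v \<equiv> pos (of_int u + 1/3) (of_int v)"

abbreviation cwt :: "int \<Rightarrow> int \<Rightarrow> real" where "cwt u v \<equiv> wt (of_int u + 1/3) (of_int v)"

abbreviation lpos :: "int \<Rightarrow> int \<Rightarrow> real" where "lpos p q \<equiv> pos (of_int p) (of_int q)"

abbreviation lwt :: "int \<Rightarrow> int \<Rightarrow> real" where "lwt p q \<equiv> wt (of_int p) (of_int q)"

definition hit :: "int \<Rightarrow> int \<Rightarrow> int \<Rightarrow> int \<Rightarrow> bool" where
  "hit p q u v \<longleftrightarrow> (0 \<le> cpos u v) \<noteq> (0 \<le> cpos (u + p) (v + q))"

definition timely :: "int \<Rightarrow> int \<Rightarrow> real \<Rightarrow> bool" where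
  "timely p q S \<longleftrightarrow> (\<exists>u v. hit p q u v \<and> S < cwt u v \<and>
      (sqrt 10 - 5/2) * (cwt u v - S) \<le> S + lwt p q)"

section \<open>Irrationality of sqrt 10 and the action of the unit\<close>

lemma sqrt10_bounds: "3.1622 < sqrt 10" "sqrt 10 < 3.1623"
  by (rule real_less_rsqrt real_less_lsqrt; simp add: power2_eq_square)+

lemma sqrt10_sq: "sqrt 10 * sqrt 10 = 10" "sqrt 10 * (sqrt 10 * x) = 10 * x"
  by (auto simp flip: mult.assoc)

lemma sqrt10_irrational: "sqrt 10 \<notin> \<rat>"
proof
  assume "sqrt 10 \<in> \<rat>"
  then obtain m n :: nat where n: "n \<noteq> 0" and e: "\<bar>sqrt 10\<bar> = real m / real n" and co: "coprime m n"
    by (rule Rats_abs_nat_div_natE)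
  have "real m = sqrt 10 * real n" using n e by (simp add: field_simps)
  then have "(real m)\<^sup>2 = 10 * (real n)\<^sup>2" by (simp add: power_mult_distrib)
  then have m2: "m\<^sup>2 = 10 * n\<^sup>2" by (metis of_nat_eq_iff of_nat_mult of_nat_numeral of_nat_power)
  then have "even (m\<^sup>2)" by simp
  then have "even m" by simp
  then obtain k where "m = 2 * k" by (rule evenE)
  with m2 have "2 * k\<^sup>2 = 5 * n\<^sup>2" by (simp add: power_mult_distrib)
  then have "even (5 * n\<^sup>2)" by (metis dvd_triv_left)
  then have "even n" by simp
  with \<open>even m\<close> co show False by (meson coprime_def odd_one)
qed

text \<open>Excludes the one value at which a negative multiplier does not reverse the test
  \<open>0 \<le> z\<close>. A zero would force \<open>v = 0\<close> by irrationality, and then 3u +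
  1 = 0.\<close>

lemma pos_coset_nonzero: "cpos u v \<noteq> 0"
proof
  assume "cpos u v = 0"
  then have e: "of_int v * sqrt 10 = of_int (2 * v - 3 * u - 1)"
    by (simp add: pos_def slope_def field_simps)
  show False
  proof (cases "v = 0")
    case True
    with e have "of_int (3 * u + 1) = (0::real)" by simp
    then have "3 * u + 1 = 0" by (simp only: of_int_eq_0_iff)
    then show False by presburger
  next
    case False
    with e have "sqrt 10 = of_int (2 * v - 3 * u - 1) / of_int v" by (simp add: field_simps)
    then have "sqrt 10 \<in> \<rat>" by (metis Rats_divide Rats_of_int)
    with sqrt10_irrational show False by simp
  qed
qed

text \<open>The unit is 1 - 3 \<theta>, and 3 \<theta>^2 = 2 - 4 \<theta> yields these
  coefficients.\<close>

lemma pos_scale: "pos (x - 2 * y) (5 * y - 3 * x) = (3 - sqrt 10) * pos x y"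
  by (simp add: pos_def slope_def field_simps sqrt10_sq)

lemma wt_scale: "wt (x - 2 * y) (5 * y - 3 * x) = (3 + sqrt 10) * wt x y"
  by (simp add: wt_def coslope_def field_simps sqrt10_sq)

lemma pos_scale_coset:
  "cpos (u - 2 * v) (5 * v - 3 * u - 1) = (3 - sqrt 10) * cpos u v"
  using pos_scale[of "of_int u + 1/3" "of_int v"] by (simp add: algebra_simps)

lemma wt_scale_coset:
  "cwt (u - 2 * v) (5 * v - 3 * u - 1) = (3 + sqrt 10) * cwt u v"
  using wt_scale[of "of_int u + 1/3" "of_int v"] by (simp add: algebra_simps)

lemma hit_scale:
  "hit (p - 2 * q) (5 * q - 3 * p) (u - 2 * v) (5 * v - 3 * u - 1) \<longleftrightarrow> hit p q u v"
proof -
  have flip: "0 \<le> (3 - sqrt 10) * a \<longleftrightarrow> \<not> 0 \<le> a" if "a \<noteq> 0" for a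
    using that sqrt10_bounds by (auto simp: zero_le_mult_iff)
  have 1: "0 \<le> cpos (u - 2 * v) (5 * v - 3 * u - 1) \<longleftrightarrow> \<not> 0 \<le> cpos u v" for u v
    unfolding pos_scale_coset by (rule flip[OF pos_coset_nonzero])
  have 2: "u - 2 * v + (p - 2 * q) = (u + p) - 2 * (v + q)"
    "5 * v - 3 * u - 1 + (5 * q - 3 * p) = 5 * (v + q) - 3 * (u + p) - 1" by auto
  show ?thesis unfolding hit_def 2 1 by blast
qed

lemma timely_scale:
  assumes "timely p q S"
  shows "timely (p - 2 * q) (5 * q - 3 * p) ((3 + sqrt 10) * S)"
proof -
  from assms obtain u v where h: "hit p q u v" and l: "S < cwt u v"
    and c: "(sqrt 10 - 5/2) * (cwt u v - S) \<le> S + lwt p q"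
    unfolding timely_def by blast
  have e: "lwt (p - 2 * q) (5 * q - 3 * p) = (3 + sqrt 10) * lwt p q"
    using wt_scale[of p q] by simp
  have pos: "0 < 3 + sqrt 10" using sqrt10_bounds by simp
  show ?thesis unfolding timely_def
  proof (intro exI conjI)
    show "hit (p - 2 * q) (5 * q - 3 * p) (u - 2 * v) (5 * v - 3 * u - 1)"
      using h hit_scale by blast
    show "(3 + sqrt 10) * S < cwt (u - 2 * v) (5 * v - 3 * u - 1)"
      unfolding wt_scale_coset using l pos by simp
    show "(sqrt 10 - 5/2) * (cwt (u - 2 * v) (5 * v - 3 * u - 1) - (3 + sqrt 10) * S)
      \<le> (3 + sqrt 10) * S + lwt (p - 2 * q) (5 * q - 3 * p)"
      unfolding wt_scale_coset e using mult_left_mono[OF c, of "3 + sqrt 10"] pos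
      by (simp only: distrib_left right_diff_distrib mult.left_commute[of "sqrt 10 - 5/2"])
  qed
qed

section \<open>Returns to a strip, and the lower bound for particular \<lambda>\<close>

lemma cpos_add: "cpos (u + p) (v + q) = cpos u v + lpos p q"
  by (simp add: pos_def algebra_simps)

text \<open>If \<open>z + a\<close> overshoots the strip, then \<open>z + b\<close> stays in it because \<open>a - b\<close> is at most its width.\<close>

lemma strip_return:
  fixes lo hi G S :: real and a1 a2 b1 b2 u v :: int
  assumes a: "0 < lpos a1 a2" and b: "lpos b1 b2 < 0" and ab: "lpos a1 a2 - lpos b1 b2 \<le> hi - lo"
    and wa: "0 < lwt a1 a2" "lwt a1 a2 \<le> G" and wb: "0 < lwt b1 b2" "lwt b1 b2 \<le> G"
    and z: "lo \<le> cpos u v" "cpos u v < hi"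
    and S: "cwt u v \<le> S"
  shows "\<exists>u v. lo \<le> cpos u v \<and> cpos u v < hi \<and>
    S < cwt u v \<and> cwt u v \<le> S + G"
proof -
  define m where "m = min (lwt a1 a2) (lwt b1 b2)"
  have m: "0 < m" "m \<le> lwt a1 a2" "m \<le> lwt b1 b2" using wa wb by (auto simp: m_def)
  \<comment> \<open>\<open>N\<close> bounds the number of steps, each adding at least
    \<open>m\<close> to the weight, that suffice to exceed \<open>S\<close>.\<close>
  have "S < cwt u v + real N * m \<Longrightarrow> ?thesis"
    if "lo \<le> cpos u v" "cpos u v < hi"
       "cwt u v \<le> S" for N and u v :: int
    using that
  proof (induction N arbitrary: u v)
    case 0
    then show ?case by simp
  next
    case (Suc N)
    have step: ?thesis if d: "lo \<le> cpos (u + d1) (v + d2)"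
        "cpos (u + d1) (v + d2) < hi"
        "m \<le> lwt d1 d2" "lwt d1 d2 \<le> G" for d1 d2 :: int
    proof -
      have w: "cwt (u + d1) (v + d2) = cwt u v + lwt d1 d2"
        by (simp add: wt_def algebra_simps)
      show ?thesis
      proof (cases "cwt (u + d1) (v + d2) \<le> S")
        case True
        then show ?thesis
          using Suc.IH[of "u + d1" "v + d2"] Suc.prems d w by (simp add: algebra_simps)
      next
        case False
        then show ?thesis
          using d w Suc.prems by (intro exI[of _ "u + d1"] exI[of _ "v + d2"]) auto
      qed
    qed
    show ?case
    proof (cases "cpos u v + lpos a1 a2 < hi")
      case True
      then show ?thesis using step[of a1 a2] Suc.prems a wa m unfolding cpos_add by simp
    next
      case False
      then show ?thesis using step[of b1 b2] Suc.prems a b ab wb m unfolding cpos_add by simp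
    qed
  qed
  moreover obtain N where "(S - cwt u v) / m < real N"
    using reals_Archimedean2 by blast
  then have "S < cwt u v + real N * m" using m by (simp add: field_simps)
  ultimately show ?thesis using z S by blast
qed

lemma hit_iff:
  "hit p q u v \<longleftrightarrow> 0 \<le> cpos u v \<and> cpos u v < - lpos p q \<or> cpos u v < 0 \<and> - lpos p q \<le> cpos u v"
  unfolding hit_def cpos_add by linarith

text \<open>All points of the strip are hits. While \<open>S\<close> is below the weight of the
  start point, that point serves; as c (w - S) - S decreases in \<open>S\<close>, only
  \<open>S = T\<close> needs checking, which is \<open>first\<close>. Beyond it the next return
  costs at most \<open>G\<close>, and \<open>ret\<close> suffices. In the applications a - b is
  exactly the width of the strip and \<open>G\<close> the larger of the two weights.\<close>

lemma timelyI:
  assumes strip: "lo = 0 \<and> lpos p q \<le> - hi \<or> hi = 0 \<and> - lo \<le> lpos p q"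
    and W: "W \<le> lwt p q"
    and a: "0 < lpos a1 a2" and b: "lpos b1 b2 < 0" and ab: "lpos a1 a2 - lpos b1 b2 \<le> hi - lo"
    and wa: "0 < lwt a1 a2" "lwt a1 a2 \<le> G" and wb: "0 < lwt b1 b2" "lwt b1 b2 \<le> G"
    and z: "lo \<le> cpos u v" "cpos u v < hi"
    and first: "(sqrt 10 - 5/2) * (cwt u v - T) \<le> T + W"
    and ret: "(sqrt 10 - 5/2) * G \<le> cwt u v + W"
    and S: "T \<le> S"
  shows "timely p q S"
proof -
  have hits: "hit p q u v" if "lo \<le> cpos u v" "cpos u v < hi" for u v
    unfolding hit_iff using strip that by linarith
  show ?thesis
  proof (cases "S < cwt u v")
    case True
    have "(sqrt 10 - 5/2) * (cwt u v - S) \<le> (sqrt 10 - 5/2) * (cwt u v - T)"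
      using S sqrt10_bounds by (intro mult_left_mono) auto
    then have "(sqrt 10 - 5/2) * (cwt u v - S) \<le> S + lwt p q" using first S W by linarith
    then show ?thesis unfolding timely_def using hits[OF z] True by blast
  next
    case False
    then have "cwt u v \<le> S" by simp
    from strip_return[OF a b ab wa wb z this] obtain u' v'
      where uv: "lo \<le> cpos u' v'" "cpos u' v' < hi" "S < cwt u' v'" "cwt u' v' \<le> S + G" by blast
    have "(sqrt 10 - 5/2) * (cwt u' v' - S) \<le> (sqrt 10 - 5/2) * G"
      using uv sqrt10_bounds by (intro mult_left_mono) auto
    then have "(sqrt 10 - 5/2) * (cwt u' v' - S) \<le> S + lwt p q" using False ret W by linarith
    then show ?thesis unfolding timely_def using uv hits by blast
  qed
qed

lemmas num_simps = pos_def wt_def slope_def coslope_def field_simps sqrt10_sq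

lemma timely_base_neg:
  assumes "lpos p q \<le> -1" "1 \<le> lwt p q" "0 \<le> S"
  shows "timely p q S"
  by (rule timelyI[where lo = 0 and hi = 1 and ?a1.0 = 0 and ?a2.0 = 1 and ?b1.0 = "-1" and ?b2.0 = 1
        and G = "coslope + 1" and u = 0 and v = 1 and T = 0 and W = 1])
    (use assms sqrt10_bounds in \<open>simp_all add: num_simps\<close>)

lemma timely_base_pos:
  assumes "1 \<le> lpos p q" "1 \<le> lwt p q" "0 \<le> S"
  shows "timely p q S"
\<comment> \<open>Neither start point serves alone when \<lambda> has weight 1: from the hit of
  weight 2/3 the return bound fails, and the hit of weight \<open>coslope + 2/3\<close> is too late
  for \<open>S = 0\<close>.\<close>
proof (cases "S < 2/3")
  case True
  have "hit p q (-1) 0" unfolding hit_iff using assms by (simp add: pos_def)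
  moreover have "(sqrt 10 - 5/2) * (2/3 - S) \<le> 1 * (2/3 - S)"
    using True sqrt10_bounds by (intro mult_right_mono) auto
  moreover have "cwt (-1) 0 = 2/3" by (simp add: wt_def)
  moreover have "1 * (2/3 - S) \<le> S + lwt p q" using assms by simp
  ultimately show ?thesis unfolding timely_def using True by (metis order_trans)
next
  case False
  show ?thesis
  by (rule timelyI[where lo = "-1" and hi = 0 and ?a1.0 = 0 and ?a2.0 = 1 and ?b1.0 = "-1" and ?b2.0 = 1
        and G = "coslope + 1" and u = "-1" and v = 1 and T = "2/3" and W = 1])
    (use assms False sqrt10_bounds in \<open>simp_all add: num_simps\<close>)
qed

lemma timely_base_slope:
  assumes "slope \<le> lpos p q" "coslope \<le> lwt p q" "0 \<le> S"
  shows "timely p q S"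
  by (rule timelyI[where lo = "- slope" and hi = 0 and ?a1.0 = "-1" and ?a2.0 = 3 and ?b1.0 = "-1" and ?b2.0 = 2
        and G = "3 + sqrt 10" and u = "-1" and v = 1 and T = 0 and W = coslope])
    (use assms sqrt10_bounds in \<open>simp_all add: num_simps\<close>)

text \<open>The extremal case: the start point has weight \<open>2 * coslope + 2/3\<close>, and
  \<open>coslope + 1\<close> is exactly \<open>sqrt 10 - 5/2\<close> times that, so
  \<open>first\<close> is an equality.\<close>

lemma timely_base_m1_1:
  assumes "0 \<le> S"
  shows "timely (-1) 1 S"
  by (rule timelyI[where lo = 0 and hi = "1 - slope" and ?a1.0 = 0 and ?a2.0 = 1 and ?b1.0 = "-1" and ?b2.0 = 2
        and G = "2 * coslope + 1" and u = "-1" and v = 2 and T = 0 and W = "coslope + 1"])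
    (use assms sqrt10_bounds in \<open>simp_all add: num_simps\<close>)

lemma timely_base_m1_2:
  assumes "0 \<le> S"
  shows "timely (-1) 2 S"
  by (rule timelyI[where lo = 0 and hi = "1 - 2 * slope" and ?a1.0 = "-1" and ?a2.0 = 3 and ?b1.0 = "-2" and ?b2.0 = 5
        and G = "5 * coslope + 2" and u = "-1" and v = 2 and T = 0 and W = "2 * coslope + 1"])
    (use assms sqrt10_bounds in \<open>simp_all add: num_simps\<close>)

section \<open>One period of weights, and descent by the unit\<close>

lemma lpos_lwt: "lpos p q + lwt p q = of_int q * (2 * sqrt 10 / 3)"
  by (simp add: num_simps)

lemma cpos_cwt: "cpos u v + cwt u v = of_int v * (2 * sqrt 10 / 3)"
  by (simp add: num_simps)

lemma int_between:
  assumes "of_int a - 1 < (of_int x :: real)" "(of_int x :: real) < of_int b + 1"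
  shows "a \<le> x" "x \<le> b"
proof -
  have "real_of_int (a - 1) < of_int x" "real_of_int x < of_int (b + 1)" using assms by auto
  then show "a \<le> x" "x \<le> b" by (simp_all only: of_int_less_iff)
qed

text \<open>Once the position lies strictly between -1 and 1, q D < 4 + sqrt 10 < 4 D leaves only q
  = 1, 2, 3.\<close>

lemma timely_base:
  assumes "1 \<le> lwt p q" "lwt p q < 3 + sqrt 10" "0 \<le> S"
  shows "timely p q S"
proof (cases "lpos p q \<le> -1 \<or> 1 \<le> lpos p q")
  case True
  then show ?thesis using timely_base_neg timely_base_pos assms by blast
next
  case False
  then have l: "-1 < lpos p q" "lpos p q < 1" by auto
  define D where "D = 2 * sqrt 10 / 3"
  have D: "2 < D" using sqrt10_bounds by (simp add: D_def)
  have qD: "0 < of_int q * D" "of_int q * D < 4 + sqrt 10"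
    using lpos_lwt[of p q] l assms unfolding D_def by linarith+
  have "0 < real_of_int q" using qD(1) D by (simp add: zero_less_mult_iff)
  moreover have "real_of_int q < 4"
  proof (rule ccontr)
    assume "\<not> real_of_int q < 4"
    then have "4 * D \<le> of_int q * D" using D by simp
    then have "4 * D < 4 + sqrt 10" using qD by linarith
    with sqrt10_bounds show False by (simp add: D_def)
  qed
  ultimately have "q = 1 \<or> q = 2 \<or> q = 3" using int_between[of 1 q 3] by auto
  then consider "q = 1" | "q = 2" | "q = 3" by blast
  then show ?thesis
  proof cases
    case 1
    have "-1 \<le> p \<and> p \<le> 0"
      using int_between[of "-1" p 0] l 1 sqrt10_bounds by (simp add: num_simps)
    then have "p = -1 \<or> p = 0" by auto
    then show ?thesis using 1 timely_base_m1_1[of S] timely_base_slope[of p q S] assms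
      by (auto simp: pos_def wt_def)
  next
    case 2
    have "-1 \<le> p \<and> p \<le> 0"
      using int_between[of "-1" p 0] l 2 sqrt10_bounds by (simp add: num_simps)
    then have "p = -1 \<or> p = 0" by auto
    moreover have "0 \<le> slope" "0 \<le> coslope" using sqrt10_bounds by (simp_all add: num_simps)
    ultimately show ?thesis using 2 timely_base_m1_2[of S] timely_base_slope[of p q S] assms
      by (auto simp: pos_def wt_def)
  next
    case 3
    have "-2 \<le> p \<and> p \<le> -1"
      using int_between[of "-2" p "-1"] l 3 sqrt10_bounds by (simp add: num_simps)
    then have "p = -2 \<or> p = -1" by auto
    \<comment> \<open>Both weights are out of range; for \<open>p = -1\<close> the weight is exactly
      \<open>3 + sqrt 10\<close>, so the strict upper bound matters.\<close>
    then show ?thesis using 3 assms by (auto simp: num_simps)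
  qed
qed

lemma timely_all:
  assumes "1 \<le> lwt p q" "0 \<le> S"
  shows "timely p q S"
proof -
  have e: "1 < 3 + sqrt 10" "0 < 3 + sqrt 10" using sqrt10_bounds by auto
  have "lwt p q < (3 + sqrt 10) ^ N \<Longrightarrow> ?thesis" for N
    using assms
  proof (induction N arbitrary: p q S)
    case 0
    then show ?case by simp
  next
    case (Suc N)
    show ?case
    proof (cases "lwt p q < 3 + sqrt 10")
      case True
      then show ?thesis using timely_base Suc.prems by blast
    next
      case False
      \<comment> \<open>Division by the unit 3 - sqrt 10, which divides the weight by
        \<open>3 + sqrt 10\<close>.\<close>
      define p' q' where "p' = - 5 * p - 2 * q" and "q' = - 3 * p - q"
      have pq: "p = p' - 2 * q'" "q = 5 * q' - 3 * p'" by (auto simp: p'_def q'_def)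
      have w: "lwt p q = (3 + sqrt 10) * lwt p' q'"
        using wt_scale[of "of_int p'" "of_int q'"] unfolding pq by simp
      have "lwt p' q' < (3 + sqrt 10) ^ N"
        using Suc.prems(1) e(2) unfolding w power_Suc by (simp only: mult_less_cancel_left_pos)
      moreover have "1 \<le> lwt p' q'"
        using False e unfolding w by (simp add: not_less)
      moreover have "0 \<le> S / (3 + sqrt 10)" using Suc.prems(3) e by simp
      ultimately have "timely p' q' (S / (3 + sqrt 10))" by (rule Suc.IH)
      from timely_scale[OF this] show ?thesis using e(2) pq by simp
    qed
  qed
  then show ?thesis using real_arch_pow[OF e(1)] by blast
qed

section \<open>From hits to repeated factors of the word\<close>

definition rotfloor :: "int \<Rightarrow> int" where "rotfloor v = \<lfloor>of_int v * slope + 1/3\<rfloor>"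

abbreviation word :: "nat \<Rightarrow> int" where
  "word \<equiv> sturmian ((sqrt 10 - 2) / 3) ((sqrt 10 - 1) / 3)"

lemma word_eq: "word n = rotfloor (int n + 2) - rotfloor (int n + 1)"
proof -
  have "(real n + 1) * ((sqrt 10 - 2) / 3) + (sqrt 10 - 1) / 3 = of_int (int n + 2) * slope + 1/3"
    "real n * ((sqrt 10 - 2) / 3) + (sqrt 10 - 1) / 3 = of_int (int n + 1) * slope + 1/3"
    by (simp_all add: slope_def field_simps)
  then show ?thesis unfolding sturmian_def rotfloor_def by (simp only:)
qed

lemma cpos_nonneg_iff: "0 \<le> cpos u v \<longleftrightarrow> - u \<le> rotfloor v"
  unfolding rotfloor_def pos_def le_floor_iff of_int_minus by linarith

text \<open>For fixed \<open>v\<close>, the signs of z and z + \<lambda> change at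
  \<open>u = - rotfloor v\<close> and \<open>u = p - rotfloor (v + q)\<close>; there is no hit
  exactly when these thresholds coincide.\<close>

lemma no_hit_iff: "(\<forall>u. \<not> hit (- p) q u v) \<longleftrightarrow> rotfloor (v + q) - rotfloor v = p"
proof
  assume *: "\<forall>u. \<not> hit (- p) q u v"
  have "\<not> hit (- p) q (- rotfloor v) v" "\<not> hit (- p) q (p - rotfloor (v + q)) v"
    using * by blast+
  then show "rotfloor (v + q) - rotfloor v = p" unfolding hit_def cpos_nonneg_iff by simp
next
  assume "rotfloor (v + q) - rotfloor v = p"
  then show "\<forall>u. \<not> hit (- p) q u v" unfolding hit_def cpos_nonneg_iff by auto
qed

text \<open>Letters are increments of \<open>rotfloor\<close>, so equality telescopes; n letters
  involve n + 1 values, hence \<open>k \<le> n\<close>.\<close>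

lemma factor_eq_word_iff:
  "factor_eq word n i j \<longleftrightarrow> (\<forall>k\<le>n. rotfloor (int (j + k) + 1) - rotfloor (int (i + k) + 1)
      = rotfloor (int j + 1) - rotfloor (int i + 1))"
proof (induction n)
  case 0
  then show ?case by (simp add: factor_eq_def)
next
  case (Suc n)
  have "factor_eq word (Suc n) i j \<longleftrightarrow> factor_eq word n i j \<and> word (i + n) = word (j + n)"
    by (auto simp: factor_eq_def less_Suc_eq)
  moreover have "word (i + n) = word (j + n) \<longleftrightarrow>
      rotfloor (int (j + Suc n) + 1) - rotfloor (int (i + Suc n) + 1)
      = rotfloor (int (j + n) + 1) - rotfloor (int (i + n) + 1)"
    by (auto simp: word_eq algebra_simps)
  ultimately show ?case using Suc.IH by (auto simp: le_Suc_eq)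
qed

lemma factor_eq_word_bound:
  assumes "i < j" "factor_eq word n i j"
  shows "(sqrt 10 - 5/2) * real n \<le> real j + 2"
proof -
  define p q D where "p = rotfloor (int j + 1) - rotfloor (int i + 1)" and "q = int j - int i"
    and "D = 2 * sqrt 10 / 3"
  have D: "2 < D" using sqrt10_bounds by (simp add: D_def)
  have q: "1 \<le> q" using assms by (simp add: q_def)
  have nohit: "\<not> hit (- p) q u v" if "int i + 1 \<le> v" "v \<le> int i + 1 + int n" for u v
  proof -
    define k where "k = nat (v - int i - 1)"
    have "k \<le> n" "v = int (i + k) + 1" "v + q = int (j + k) + 1"
      using that by (auto simp: k_def q_def)
    then show ?thesis using assms(2) no_hit_iff[of p q v]
      unfolding factor_eq_word_iff p_def by metis
  qed
  have "\<bar>lpos (- p) q\<bar> < 1"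
  proof -
    have fl: "of_int (rotfloor v) \<le> of_int v * slope + 1/3"
      "of_int v * slope + 1/3 < of_int (rotfloor v) + 1" for v
      unfolding rotfloor_def by linarith+
    show ?thesis using fl[of "int j + 1"] fl[of "int i + 1"]
      by (simp add: pos_def p_def q_def algebra_simps)
  qed
  then have l: "-1 < lpos (- p) q" "lpos (- p) q < 1" by auto
  have lw: "lpos (- p) q + lwt (- p) q = of_int q * D" unfolding D_def by (rule lpos_lwt)
  have "D \<le> of_int q * D" using q D by simp
  then have W: "1 \<le> lwt (- p) q" using lw l D by linarith
  \<comment> \<open>The weight at the start of the window, up to an error below 1. A hit of larger
    weight has \<open>v \<ge> i + 1\<close>, hence lies beyond the window, which contains
    none.\<close>
  define S where "S = (real i + 1) * D"
  have "0 \<le> S" using D by (simp add: S_def)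
  with timely_all[OF W] obtain u v where uv: "hit (- p) q u v" "S < cwt u v"
    "(sqrt 10 - 5/2) * (cwt u v - S) \<le> S + lwt (- p) q" unfolding timely_def by blast
  have z: "-1 < cpos u v" "cpos u v < 1" using uv(1) l unfolding hit_iff by linarith+
  have zw: "cpos u v + cwt u v = of_int v * D" unfolding D_def by (rule cpos_cwt)
  have "real i * D < of_int v * D" using uv(2) z zw D unfolding S_def distrib_right by linarith
  then have "real_of_int (int i) < of_int v" using D by simp
  then have "int i + 1 \<le> v" by linarith
  then have "int i + 1 + int n < v" using nohit uv(1) not_le by blast
  then have "real i + 2 + real n \<le> of_int v" by linarith
  then have "(real i + 2 + real n) * D \<le> of_int v * D" using D by simp
  then have "(real n + 1) * D - 1 \<le> cwt u v - S" using zw z unfolding S_def by (simp add: algebra_simps)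
  then have "real n * D \<le> cwt u v - S" using D by (simp add: algebra_simps)
  then have "(sqrt 10 - 5/2) * (real n * D) \<le> (sqrt 10 - 5/2) * (cwt u v - S)"
    using sqrt10_bounds by (intro mult_left_mono) auto
  also have "\<dots> \<le> S + lwt (- p) q" by fact
  also have "\<dots> \<le> (real i + 1) * D + of_int q * D + 1" using lw l S_def by linarith
  also have "\<dots> \<le> (real j + 2) * D" using D by (simp add: q_def algebra_simps)
  finally have "((sqrt 10 - 5/2) * real n) * D \<le> (real j + 2) * D" by (simp add: mult.assoc)
  then show ?thesis using D by simp
qed

section \<open>The extremal repetitions\<close>

lemma extremal_hits:
  "\<exists>p q u v. lwt p q = (sqrt 10 - 5/2) * cwt u v \<and> \<bar>lpos p q\<bar> < 1 \<and> \<bar>cpos u v\<bar> < 1 \<and>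
    cwt u v = (3 + sqrt 10) ^ k * (2 * coslope + 2/3) \<and>
    (\<forall>u' v'. hit p q u' v' \<longrightarrow> 0 < cwt u' v' \<longrightarrow> cwt u v \<le> cwt u' v')"
proof (induction k)
  case 0
  \<comment> \<open>For \<lambda> = \<theta> - 1 the hits fill the strip from 0 to 1 - \<theta>.
    Positive weight forces \<open>v \<ge> 1\<close>, no hit has \<open>v = 1\<close>, and the only
    one with \<open>v = 2\<close> is 2 \<theta> - 2/3.\<close>
  have min: "cwt (-1) 2 \<le> cwt u v" if h: "hit (-1) 1 u v" "0 < cwt u v" for u v
  proof (rule ccontr)
    assume "\<not> cwt (-1) 2 \<le> cwt u v"
    then have c: "cwt u v < 2 * coslope + 2/3" by (simp add: wt_def)
    have z: "0 \<le> cpos u v" "cpos u v < 1 - slope"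
    proof -
      have "lpos (-1) 1 = slope - 1" "slope < 1" using sqrt10_bounds by (simp_all add: num_simps)
      then show "0 \<le> cpos u v" "cpos u v < 1 - slope" using h(1) unfolding hit_iff by linarith+
    qed
    have zw: "cpos u v + cwt u v = of_int v * (2 * sqrt 10 / 3)" by (rule cpos_cwt)
    have "0 < of_int v * (2 * sqrt 10 / 3)" using z h zw by linarith
    then have "0 < real_of_int v" by (simp add: zero_less_mult_iff)
    moreover have "real_of_int v < 3"
    proof (rule ccontr)
      assume "\<not> real_of_int v < 3"
      then have "3 * (2 * sqrt 10 / 3) \<le> of_int v * (2 * sqrt 10 / 3)" by (intro mult_right_mono) auto
      then have "2 * sqrt 10 < 1 - slope + (2 * coslope + 2/3)" using zw c z by linarith
      then show False using sqrt10_bounds by (simp add: num_simps)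
    qed
    ultimately have "v = 1 \<or> v = 2" using int_between[of 1 v 2] by auto
    then show False
    proof
      assume v: "v = 1"
      have "0 \<le> u" "u \<le> -1"
        using int_between[of 0 u "-1"] z v sqrt10_bounds by (simp_all add: num_simps)
      then show False by simp
    next
      assume v: "v = 2"
      have "-1 \<le> u" "u \<le> -1"
        using int_between[of "-1" u "-1"] z v sqrt10_bounds by (simp_all add: num_simps)
      then have "u = -1" by simp
      with v c show False by (simp add: wt_def)
    qed
  qed
  show ?case
    by (rule exI[of _ "-1"], rule exI[of _ 1], rule exI[of _ "-1"], rule exI[of _ 2], intro conjI allI impI min)
      (use sqrt10_bounds in \<open>simp_all add: num_simps\<close>)
next
  case (Suc k)
  have e: "0 < 3 + sqrt 10" "\<bar>3 - sqrt 10\<bar> < 1" using sqrt10_bounds by auto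
  from Suc obtain p q u v where w: "lwt p q = (sqrt 10 - 5/2) * cwt u v" and l: "\<bar>lpos p q\<bar> < 1"
    and z: "\<bar>cpos u v\<bar> < 1" and c: "cwt u v = (3 + sqrt 10) ^ k * (2 * coslope + 2/3)"
    and m: "\<And>u' v'. hit p q u' v' \<Longrightarrow> 0 < cwt u' v' \<Longrightarrow> cwt u v \<le> cwt u' v'" by blast
  \<comment> \<open>The unit has absolute value below 1, so the position bounds persist and weight
    still measures time up to a bounded error.\<close>
  have shrink: "\<bar>(3 - sqrt 10) * a\<bar> < 1" if "\<bar>a\<bar> < 1" for a
    using that e(2) mult_strict_mono'[of "\<bar>3 - sqrt 10\<bar>" 1 "\<bar>a\<bar>" 1] by (simp add: abs_mult)
  show ?case
  proof (rule exI[of _ "p - 2 * q"], rule exI[of _ "5 * q - 3 * p"], rule exI[of _ "u - 2 * v"],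
      rule exI[of _ "5 * v - 3 * u - 1"], intro conjI allI impI)
    show "lwt (p - 2 * q) (5 * q - 3 * p) = (sqrt 10 - 5/2) * cwt (u - 2 * v) (5 * v - 3 * u - 1)"
      unfolding wt_scale_coset using wt_scale[of "of_int p" "of_int q"] w by simp
    show "\<bar>lpos (p - 2 * q) (5 * q - 3 * p)\<bar> < 1"
      using shrink[OF l] pos_scale[of "of_int p" "of_int q"] by simp
    show "\<bar>cpos (u - 2 * v) (5 * v - 3 * u - 1)\<bar> < 1"
      unfolding pos_scale_coset by (rule shrink[OF z])
    show "cwt (u - 2 * v) (5 * v - 3 * u - 1) = (3 + sqrt 10) ^ Suc k * (2 * coslope + 2/3)"
      unfolding wt_scale_coset c by simp
  next
    fix x y assume h: "hit (p - 2 * q) (5 * q - 3 * p) x y" and pos: "0 < cwt x y"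
    \<comment> \<open>Division by the unit on the coset; the constants -2 and -1 come from the
      offset 1/3.\<close>
    define u' v' where "u' = - 5 * x - 2 * y - 2" and "v' = - 3 * x - y - 1"
    have xy: "x = u' - 2 * v'" "y = 5 * v' - 3 * u' - 1" by (auto simp: u'_def v'_def)
    have "hit p q u' v'" using h hit_scale unfolding xy by blast
    moreover have "0 < cwt u' v'" using pos e(1) unfolding xy wt_scale_coset
      by (simp add: zero_less_mult_iff)
    ultimately show "cwt (u - 2 * v) (5 * v - 3 * u - 1) \<le> cwt x y"
      using m e(1) unfolding xy wt_scale_coset by simp
  qed
qed

lemma early_repetition:
  obtains n q where "N \<le> n" "1 \<le> q" "factor_eq word n 1 (1 + q)"
    "real q \<le> (sqrt 10 - 5/2) * real n + 3"
proof -
  define D where "D = 2 * sqrt 10 / 3"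
  have D: "2.1 < D" using sqrt10_bounds by (simp add: D_def)
  obtain k where "(real N + 3) * D + 1 < (3 + sqrt 10) ^ k"
    using real_arch_pow[of "3 + sqrt 10"] sqrt10_bounds by auto
  moreover have "1 \<le> 2 * coslope + 2/3" using sqrt10_bounds by (simp add: num_simps)
  ultimately have big: "(real N + 3) * D + 1 < (3 + sqrt 10) ^ k * (2 * coslope + 2/3)"
    using mult_left_mono[of 1 "2 * coslope + 2/3" "(3 + sqrt 10) ^ k"]
    by (smt (verit) mult.right_neutral real_sqrt_ge_0_iff zero_le_power)
  obtain p Q u v where w: "lwt p Q = (sqrt 10 - 5/2) * cwt u v" and l: "\<bar>lpos p Q\<bar> < 1"
    and z: "\<bar>cpos u v\<bar> < 1" and c: "cwt u v = (3 + sqrt 10) ^ k * (2 * coslope + 2/3)"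
    and m: "\<And>u' v'. hit p Q u' v' \<Longrightarrow> 0 < cwt u' v' \<Longrightarrow> cwt u v \<le> cwt u' v'"
    using extremal_hits[of k] by blast
  have zw: "cpos u v + cwt u v = of_int v * D" for u v unfolding D_def by (rule cpos_cwt)
  have lw: "lpos p Q + lwt p Q = of_int Q * D" unfolding D_def by (rule lpos_lwt)
  have "(real N + 3) * D < of_int v * D" using zw[of u v] z big c by linarith
  then have "real N + 3 < of_int v" using D by simp
  then have v: "int N + 3 < v" by linarith
  \<comment> \<open>For \<open>i = 1\<close> the window is 2, ..., n + 2, so this \<open>n\<close>
    puts the first hit \<open>v\<close> just past its end.\<close>
  define n where "n = nat (v - 3)"
  have n: "v = int n + 3" "N \<le> n" using v by (auto simp: n_def)
  have "3 * D \<le> (real N + 3) * D" using D by simp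
  then have c7: "7 < cwt u v" using big c D by linarith
  have "(sqrt 10 - 5/2) * 7 < lwt p Q"
    unfolding w using c7 sqrt10_bounds by (intro mult_strict_left_mono) auto
  then have "1 < lwt p Q" using sqrt10_bounds by simp
  then have "0 < of_int Q * D" using lw l by linarith
  then have "0 < real_of_int Q" using D by (simp add: zero_less_mult_iff)
  then have Q: "0 < Q" by simp
  define q where "q = nat Q"
  have q: "Q = int q" "1 \<le> q" using Q by (auto simp: q_def)
  have nohit: "\<not> hit p Q u' v'" if v': "2 \<le> v'" "v' < v" for u' v'
  proof
    assume h: "hit p Q u' v'"
    then have z': "-1 < cpos u' v'" "cpos u' v' < 1" using l unfolding hit_iff by linarith+
    have "2 * D \<le> of_int v' * D" using v' D by simp
    then have "0 < cwt u' v'" using zw[of u' v'] z' D by linarith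
    then have "cwt u v \<le> cwt u' v'" using m h by blast
    \<comment> \<open>Least weight also means first in time: the two positions contribute an error
      of at most 2, less than the time unit \<open>D\<close>.\<close>
    then have "of_int v * D \<le> of_int v' * D + 2" using zw[of u v] zw[of u' v'] z z' by linarith
    moreover have "(of_int v' + 1) * D \<le> of_int v * D" using v' D by simp
    ultimately show False using D by (simp add: distrib_right)
  qed
  have rot: "rotfloor (v' + Q) - rotfloor v' = - p" if "2 \<le> v'" "v' < v" for v'
    using no_hit_iff[of "- p" Q v'] nohit that by simp
  have "factor_eq word n 1 (1 + q)" unfolding factor_eq_word_iff
  proof (intro allI impI)
    fix k assume "k \<le> n"
    then show "rotfloor (int (1 + q + k) + 1) - rotfloor (int (1 + k) + 1) =
        rotfloor (int (1 + q) + 1) - rotfloor (int 1 + 1)"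
      using rot[of "int k + 2"] rot[of 2] n q by (simp add: algebra_simps)
  qed
  moreover have "real q \<le> (sqrt 10 - 5/2) * real n + 3"
  proof -
    have "cwt u v \<le> (real n + 3) * D + 1" using zw[of u v] z n by simp
    then have "(sqrt 10 - 5/2) * cwt u v \<le> (sqrt 10 - 5/2) * ((real n + 3) * D + 1)"
      using sqrt10_bounds by (intro mult_left_mono) auto
    then have "lwt p Q + 1 \<le> (sqrt 10 - 5/2) * ((real n + 3) * D + 1) + 1"
      unfolding w by (rule add_right_mono)
    moreover have "of_int Q * D \<le> lwt p Q + 1" using lw l by linarith
    ultimately have "of_int Q * D \<le> (sqrt 10 - 5/2) * ((real n + 3) * D + 1) + 1"
      by (rule order_trans[rotated])
    then have "real q * D \<le> (sqrt 10 - 5/2) * ((real n + 3) * D + 1) + 1"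
      unfolding q by simp
    also have "\<dots> = (sqrt 10 - 5/2) * real n * D + ((sqrt 10 - 5/2) * 3 * D + (sqrt 10 - 3/2))"
      by (simp add: algebra_simps)
    also have "\<dots> \<le> (sqrt 10 - 5/2) * real n * D + 3 * D"
      unfolding D_def using sqrt10_bounds by (intro add_left_mono) (simp add: field_simps sqrt10_sq)
    finally have "real q * D \<le> ((sqrt 10 - 5/2) * real n + 3) * D" by (simp add: algebra_simps)
    then show ?thesis using D by simp
  qed
  ultimately show thesis using that n q by blast
qed

section \<open>Bounds for \<open>rfun\<close> and the limit inferior\<close>

lemma rfun_word_ge: "(sqrt 10 - 3/2) * real n - 3 \<le> real (rfun n word)"
proof -
  let ?P = "\<lambda>m. m \<ge> 1 \<and> n \<le> m \<and> (\<exists>i. 1 \<le> i \<and> i + n \<le> m \<and> factor_eq word n i (m + 1 - n))"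
  \<comment> \<open>A longer repetition, truncated to length \<open>n\<close>, shows that the
    minimum defining \<open>rfun\<close> is attained.\<close>
  obtain n' q where nq: "n \<le> n'" "1 \<le> q" "factor_eq word n' 1 (1 + q)" by (rule early_repetition)
  then have "factor_eq word n 1 (q + n + 1 - n)" by (auto simp: factor_eq_def)
  with nq have "?P (q + n)" by (auto intro!: exI[of _ 1])
  then have "?P (LEAST m. ?P m)" by (rule LeastI)
  then have "?P (rfun n word)" unfolding rfun_def .
  then obtain i where i: "i + n \<le> rfun n word" "factor_eq word n i (rfun n word + 1 - n)" by blast
  have "(sqrt 10 - 5/2) * real n \<le> real (rfun n word + 1 - n) + 2"
    using i by (intro factor_eq_word_bound) auto
  then show ?thesis using i(1) by (simp add: of_nat_diff algebra_simps)
qed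

lemma rfun_le:
  assumes "1 \<le> q" "factor_eq x n 1 (1 + q)"
  shows "rfun n x \<le> q + n"
  unfolding rfun_def using assms by (intro Least_le) (auto intro!: exI[of _ 1])

text \<open>The error K / n vanishes in the limit, and a limit inferior needs the upper bound only
  for arbitrarily large \<open>n\<close>.\<close>

lemma liminf_div_eq:
  fixes f :: "nat \<Rightarrow> nat"
  assumes lower: "\<And>n. a * real n - K \<le> real (f n)"
    and upper: "\<And>N. \<exists>n\<ge>N. real (f n) \<le> a * real n + K"
  shows "liminf (\<lambda>n. ereal (real (f n) / real n)) = ereal a"
proof (rule antisym)
  have lim: "(\<lambda>n. a - K / real n) \<longlonglongrightarrow> a - 0" "(\<lambda>n. a + K / real n) \<longlonglongrightarrow> a + 0"
    by (intro tendsto_intros lim_const_over_n)+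
  have "ereal a = liminf (\<lambda>n. ereal (a - K / real n))"
    using lim(1) by (intro lim_imp_Liminf[symmetric]) auto
  also have "\<dots> \<le> liminf (\<lambda>n. ereal (real (f n) / real n))"
  proof (rule Liminf_mono)
    show "\<forall>\<^sub>F n in sequentially. ereal (a - K / real n) \<le> ereal (real (f n) / real n)"
      using eventually_gt_at_top[of 0]
    proof eventually_elim
      case (elim n)
      have "(a * real n - K) / real n \<le> real (f n) / real n"
        using lower by (rule divide_right_mono) simp
      with elim show ?case by (simp add: diff_divide_distrib)
    qed
  qed
  finally show "ereal a \<le> liminf (\<lambda>n. ereal (real (f n) / real n))" .
  show "liminf (\<lambda>n. ereal (real (f n) / real n)) \<le> ereal a"
  proof (rule ccontr)
    assume "\<not> ?thesis"
    then have "ereal a < liminf (\<lambda>n. ereal (real (f n) / real n))" by simp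
    then obtain y where y: "ereal a < ereal y" "ereal y < liminf (\<lambda>n. ereal (real (f n) / real n))"
      using ereal_dense2 by blast
    have "\<forall>\<^sub>F n in sequentially. y < real (f n) / real n"
      using less_LiminfD[OF y(2)] by simp
    moreover have "\<forall>\<^sub>F n in sequentially. a + K / real n < y"
      using order_tendstoD(2)[OF lim(2)] y(1) by simp
    ultimately have "\<forall>\<^sub>F n in sequentially. 0 < n \<and> a * real n + K < real (f n)"
      using eventually_gt_at_top[of 0]
    proof eventually_elim
      case (elim n)
      then have "a + K / real n < real (f n) / real n" by linarith
      then have "(a * real n + K) / real n < real (f n) / real n"
        using elim(3) by (simp add: add_divide_distrib)
      with elim(3) show ?case by (simp add: divide_less_cancel)
    qed
    then obtain N where "\<forall>n\<ge>N. a * real n + K < real (f n)"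
      unfolding eventually_sequentially by blast
    with upper[of N] show False by force
  qed
qed

theorem theorem3p5:
  shows "rep (sturmian ((sqrt 10 - 2) / 3) ((sqrt 10 - 1) / 3)) = ereal (sqrt 10 - 3 / 2)"
  unfolding rep_def
proof (rule liminf_div_eq[where K = 3])
  show "\<exists>n\<ge>N. real (rfun n word) \<le> (sqrt 10 - 3/2) * real n + 3" for N
  proof -
    obtain n q where n: "N \<le> n" "1 \<le> q" "factor_eq word n 1 (1 + q)"
      "real q \<le> (sqrt 10 - 5/2) * real n + 3" by (rule early_repetition)
    have "real (rfun n word) \<le> real q + real n" using rfun_le[OF n(2,3)] by linarith
    also have "\<dots> \<le> (sqrt 10 - 3/2) * real n + 3" using n(4) by (simp add: algebra_simps)
    finally show ?thesis using n(1) by blast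
  qed
qed (rule rfun_word_ge)

end
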